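(* Let $V_0,V_1,\dots$ be indeterminates and let $\mathbf{b}=(b_i)_{i\ge0}$, $\boldsymbol{\lambda}=(\lambda_i)_{i\ge1}$ be given by $b_i=-V_i^{-1}$ and $\lambda_i=V_i^{-1}V_{i-1}^{-1}$. For all integers $k\ge1$, $n\ge1$ and $0\le r,s\le 3k-1$, \[ \mu^{\le 3k-1}_{-n,r,s}(\mathbf{b},\boldsymbol{\lambda})=(-1)^{\lfloor r/3\rfloor+\lfloor s/3\rfloor}\frac{V_0\cdots V_s}{V_0\cdots V_{r-1}}\sum_{\pi\in\mathrm{PV}^{3,3k-1}_{n-1,r,s}}\mathrm{wt}(\pi), \] where $V_0\cdots V_{r-1}=1$ if $r=0$.
   Context: A Motzkin path is a finite sequence of points in $\mathbb{Z}\times\mathbb{Z}_{\ge0}$ whose steps are each $(1,1)$, $(1,0)$ or $(1,-1)$; its weight is the product of $b_i$ over horizontal steps starting at height $i$ and $\lambda_i$ over down steps starting at height $i$. $\mu^{\le K}_{N,r,s}(\mathbf{b},\boldsymbol{\lambda})$ ($N\ge0$) is the sum of weights of Motzkin paths from $(0,r)$ to $(N,s)$ staying weakly below $y=K$. If $(f_N)_{N\ge0}$ satisfies $f_N=c_1f_{N-1}+\cdots+c_df_{N-d}$ for all $N\ge d$ with $c_d\ne0$, it is extended uniquely to all $N\in\mathbb{Z}$ so the recurrence holds for all $N$; $\mu^{\le K}_{-N,r,s}$ denotes this extension (it exists here). $\mathrm{wt}((a_1,\dots,a_N))=V_{a_1}\cdots V_{a_N}$. A $(3,r,s)$-peak-valley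 sequence is a sequence $(a_1,\dots,a_N)$ of nonnegative integers such that, setting $a_0=r$ and $a_{N+1}=s$, for each $i=0,\dots,N+1$: if $a_i\equiv0\pmod3$ then $a_{i-1}>a_i<a_{i+1}$, and if $a_i\equiv2\pmod3$ then $a_{i-1}<a_i>a_{i+1}$, where inequalities involving $a_{-1}$ or $a_{N+2}$ are ignored. $\mathrm{PV}^{3,K}_{N,r,s}$ is the set of such sequences with $0\le a_i\le K$ for $1\le i\le N$. *)

theory Defs
  imports "HOL-Library.Poly_Mapping" "HOL-Computational_Algebra.Fraction_Field"
begin

section \<open>Motzkin paths\<close>

text \<open>Points are of type \<^typ>\<open>int \<times> nat\<close>, so paths stay weakly above the x-axis.\<close>

definition motzkin_step :: "int \<times> nat \<Rightarrow> int \<times> nat \<Rightarrow> bool" where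
  "motzkin_step p q \<longleftrightarrow>
     fst q = fst p + 1 \<and>
     (int (snd q) = int (snd p) + 1 \<or> int (snd q) = int (snd p) \<or> int (snd q) = int (snd p) - 1)"

definition motzkin_path :: "(int \<times> nat) list \<Rightarrow> bool" where
  "motzkin_path ps \<longleftrightarrow> ps \<noteq> [] \<and> successively motzkin_step ps"

definition step_weight ::
  "(nat \<Rightarrow> 'a::comm_semiring_1) \<Rightarrow> (nat \<Rightarrow> 'a) \<Rightarrow> int \<times> nat \<Rightarrow> int \<times> nat \<Rightarrow> 'a" where
  "step_weight b lam p q =
     (if snd q = snd p then b (snd p)
      else if snd q < snd p then lam (snd p)
      else 1)"

definition path_weight ::
  "(nat \<Rightarrow> 'a::comm_semiring_1) \<Rightarrow> (nat \<Rightarrow> 'a) \<Rightarrow> (int \<times> nat) list \<Rightarrow> 'a" where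
  "path_weight b lam ps = (\<Prod>i<length ps - 1. step_weight b lam (ps ! i) (ps ! Suc i))"

definition bounded_motzkin_paths :: "nat \<Rightarrow> nat \<Rightarrow> nat \<Rightarrow> nat \<Rightarrow> (int \<times> nat) list set" where
  "bounded_motzkin_paths K N r s =
     {ps. motzkin_path ps \<and> hd ps = (0, r) \<and> last ps = (int N, s) \<and> (\<forall>p\<in>set ps. snd p \<le> K)}"

definition motzkin_mu ::
  "(nat \<Rightarrow> 'a::comm_semiring_1) \<Rightarrow> (nat \<Rightarrow> 'a) \<Rightarrow> nat \<Rightarrow> nat \<Rightarrow> nat \<Rightarrow> nat \<Rightarrow> 'a" where
  "motzkin_mu b lam K N r s = (\<Sum>ps\<in>bounded_motzkin_paths K N r s. path_weight b lam ps)"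


section \<open>Extending linear recurrences to negative indices\<close>

definition recurrence_extends :: "(nat \<Rightarrow> 'a::field) \<Rightarrow> (int \<Rightarrow> 'a) \<Rightarrow> bool" where
  "recurrence_extends f g \<longleftrightarrow>
     (\<exists>d c. 1 \<le> d \<and> c d \<noteq> 0 \<and>
        (\<forall>N\<ge>d. f N = (\<Sum>i=1..d. c i * f (N - i))) \<and>
        (\<forall>N. g (int N) = f N) \<and>
        (\<forall>N. g N = (\<Sum>i=1..d. c i * g (N - int i))))"

text \<open>The extension depends neither on the recurrence satisfied by the sequence nor on its order
  (\<open>recurrence_extends_unique\<close> below), so a sequence satisfying some recurrence with nonzero last
  coefficient has exactly one.\<close>

definition negative_extension :: "(nat \<Rightarrow> 'a::field) \<Rightarrow> int \<Rightarrow> 'a" where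
  "negative_extension f = (THE g. recurrence_extends f g)"

lemma recurrence_backward_zero:
  fixes h :: "int \<Rightarrow> 'a::field"
  assumes d: "1 \<le> d" and c: "c d \<noteq> 0"
    and rec: "\<And>N. h N = (\<Sum>i=1..d. c i * h (N - int i))"
    and zero: "\<And>N. N \<ge> M \<Longrightarrow> h N = 0"
  shows "h N = 0"
proof -
  have "h (M - int n) = 0" for n
  proof (induction n rule: less_induct)
    case (less n)
    have above: "h j = 0" if "j > M - int n" for j
    proof (cases "j \<ge> M")
      case False
      then have "h (M - int (nat (M - j))) = 0"
        using that by (intro less) auto
      then show ?thesis using False by simp
    qed (simp add: zero)
    have split: "{1..d} = insert d {1..<d}"
      using d by auto
    have "0 = h (M - int n + int d)"
      using d by (subst above) auto
    also have "\<dots> = (\<Sum>i=1..d. c i * h (M - int n + int d - int i))"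
      by (rule rec)
    also have "\<dots> = c d * h (M - int n) + (\<Sum>i\<in>{1..<d}. c i * h (M - int n + int d - int i))"
      unfolding split by simp
    also have "(\<Sum>i\<in>{1..<d}. c i * h (M - int n + int d - int i)) = 0"
      by (intro sum.neutral) (auto simp: above)
    finally show ?case using c by simp
  qed
  from this[of "nat (M - N)"] show ?thesis
    by (cases "N \<ge> M") (auto simp: zero)
qed

lemma recurrence_extends_unique:
  assumes "recurrence_extends f g" "recurrence_extends f g'"
  shows "g = g'"
proof -
  obtain d c where d: "1 \<le> d" "c d \<noteq> 0"
    and g: "\<And>N. g (int N) = f N" "\<And>N. g N = (\<Sum>i=1..d. c i * g (N - int i))"
    using assms(1) unfolding recurrence_extends_def by blast
  obtain d' c' where d': "1 \<le> d'" "c' d' \<noteq> 0"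
    and g': "\<And>N. g' (int N) = f N" "\<And>N. g' N = (\<Sum>i=1..d'. c' i * g' (N - int i))"
    using assms(2) unfolding recurrence_extends_def by blast
  define h where "h = (\<lambda>N. g N - g' N)"
  define u where "u = (\<lambda>N. h N - (\<Sum>i=1..d. c i * h (N - int i)))"
  have h0: "h N = 0" if "N \<ge> 0" for N
    using g(1)[of "nat N"] g'(1)[of "nat N"] that by (simp add: h_def)
  have u': "u N = (\<Sum>i=1..d. c i * g' (N - int i)) - g' N" for N
  proof -
    have "u N = (g N - (\<Sum>i=1..d. c i * g (N - int i))) +
        ((\<Sum>i=1..d. c i * g' (N - int i)) - g' N)"
      unfolding u_def h_def right_diff_distrib sum_subtractf by simp
    then show ?thesis using g(2)[of N] by simp
  qed
  have urec: "u N = (\<Sum>j=1..d'. c' j * u (N - int j))" for N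
  proof -
    have "(\<Sum>i=1..d. c i * g' (N - int i)) =
        (\<Sum>i=1..d. \<Sum>j=1..d'. c i * (c' j * g' (N - int i - int j)))"
      unfolding sum_distrib_left[symmetric] g'(2)[symmetric] ..
    also have "\<dots> = (\<Sum>j=1..d'. \<Sum>i=1..d. c i * (c' j * g' (N - int i - int j)))"
      by (rule sum.swap)
    also have "\<dots> = (\<Sum>j=1..d'. c' j * (\<Sum>i=1..d. c i * g' (N - int j - int i)))"
      unfolding sum_distrib_left
      by (intro sum.cong refl) (simp add: mult.left_commute diff_right_commute)
    finally have swap: "(\<Sum>i=1..d. c i * g' (N - int i)) =
        (\<Sum>j=1..d'. c' j * (\<Sum>i=1..d. c i * g' (N - int j - int i)))" .
    show ?thesis
      unfolding u' right_diff_distrib sum_subtractf swap using g'(2)[of N] by simp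
  qed
  have u0: "u N = 0" for N
  proof (rule recurrence_backward_zero[of d' c' u "int d"])
    show "u M = 0" if "M \<ge> int d" for M
      unfolding u_def using that by (simp add: h0)
  qed (fact d' urec)+
  have hrec: "h N = (\<Sum>i=1..d. c i * h (N - int i))" for N
    using u0[of N] unfolding u_def by (rule eq_iff_diff_eq_0[THEN iffD2])
  have "h N = 0" for N
    by (rule recurrence_backward_zero[of d c h 0]) (fact d hrec h0)+
  then show ?thesis by (auto simp: h_def)
qed

lemma negative_extension_eq:
  "recurrence_extends f g \<Longrightarrow> negative_extension f = g"
  unfolding negative_extension_def by (blast intro: the_equality recurrence_extends_unique)

definition motzkin_mu_int ::
  "(nat \<Rightarrow> 'a::field) \<Rightarrow> (nat \<Rightarrow> 'a) \<Rightarrow> nat \<Rightarrow> int \<Rightarrow> nat \<Rightarrow> nat \<Rightarrow> 'a" where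
  "motzkin_mu_int b lam K N r s = negative_extension (\<lambda>M. motzkin_mu b lam K M r s) N"


section \<open>Peak-valley sequences\<close>

text \<open>In the list \<open>r # as @ [s]\<close> the entry at index \<open>i\<close> is $a_i$, for \<open>0 \<le> i \<le> length as + 1\<close>.\<close>

definition peak_valley3 :: "nat \<Rightarrow> nat \<Rightarrow> nat list \<Rightarrow> bool" where
  "peak_valley3 r s as \<longleftrightarrow>
     (let a = (\<lambda>i. (r # as @ [s]) ! i); N = length as in
      \<forall>i\<le>N + 1.
        (a i mod 3 = 0 \<longrightarrow>
           (i \<ge> 1 \<longrightarrow> a (i - 1) > a i) \<and> (i \<le> N \<longrightarrow> a i < a (i + 1))) \<and>
        (a i mod 3 = 2 \<longrightarrow>
           (i \<ge> 1 \<longrightarrow> a (i - 1) < a i) \<and> (i \<le> N \<longrightarrow> a i > a (i + 1))))"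

definition PV3 :: "nat \<Rightarrow> nat \<Rightarrow> nat \<Rightarrow> nat \<Rightarrow> nat list set" where
  "PV3 K N r s = {as. length as = N \<and> peak_valley3 r s as \<and> (\<forall>x\<in>set as. x \<le> K)}"

definition seq_weight :: "(nat \<Rightarrow> 'a::comm_monoid_mult) \<Rightarrow> nat list \<Rightarrow> 'a" where
  "seq_weight V as = (\<Prod>x\<leftarrow>as. V x)"


section \<open>Indeterminates\<close>

text \<open>\<open>(nat \<Rightarrow>\<^sub>0 nat) \<Rightarrow>\<^sub>0 'a\<close> is the polynomial ring over \<open>'a\<close> in indeterminates indexed by
  \<^typ>\<open>nat\<close>: an element maps exponent vectors to coefficients. The sequences below live in its
  fraction field.\<close>

type_synonym 'a rat_funs = "((nat \<Rightarrow>\<^sub>0 nat) \<Rightarrow>\<^sub>0 'a) fract"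

definition indet :: "nat \<Rightarrow> 'a::idom rat_funs" where
  "indet i = Fract (Poly_Mapping.single (Poly_Mapping.single i 1) 1) 1"

definition b_seq :: "nat \<Rightarrow> 'a::idom rat_funs" where
  "b_seq i = - inverse (indet i)"

text \<open>Only the values at \<open>i \<ge> 1\<close> matter: a down step starts at height at least 1.\<close>

definition lam_seq :: "nat \<Rightarrow> 'a::idom rat_funs" where
  "lam_seq i = inverse (indet i) * inverse (indet (i - 1))"

end

(*
  Appending or prepending a step shows that the Motzkin sums are the entries of the powers of the
  tridiagonal matrix A of size 3k with diagonal b, superdiagonal 1 and subdiagonal lambda.  With
  sigma_i = (-1)^(i div 3) and p_i = V_0 ... V_(i-1), the matrix A^(-1) has the entries
  sigma_r sigma_s p_(s+1) / p_r whenever (r, s) is an admissible pair of consecutive entries of a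
  peak-valley sequence, and 0 otherwise: after scaling, A becomes the second difference
  f(r+1) - f(r) + f(r-1), and the signed admissibility matrix is a Green function for it.  In the
  product A^(-1) ... A^(-1) the factors p telescope to the weights V, which gives the right-hand side
  as an entry of A^(-n).

  That the two-sided sequence of powers is the recurrence extension needs a recurrence whose last
  coefficient is nonzero.  It comes from the orthogonal polynomial P_3k, which annihilates A: the
  scaled values p_i P_i(0) satisfy q_(i+2) = q_(i+1) - q_i, hence have period 6 and equal (-1)^k at
  index 3k.
*)
theory Submission
  imports Defs "HOL-Computational_Algebra.Polynomial"
begin

section \<open>Motzkin paths as powers of a tridiagonal matrix\<close>

text \<open>Rows are indexed by \<open>t\<close>, columns by \<open>s\<close>. The matrix is
  infinite; truncation to heights at most \<open>K\<close> takes place only in the summation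
  ranges.\<close>

definition tridiag :: "(nat \<Rightarrow> 'a::comm_semiring_1) \<Rightarrow> (nat \<Rightarrow> 'a) \<Rightarrow> nat \<Rightarrow> nat \<Rightarrow> 'a" where
  "tridiag b lam t s =
     (if s = t then b t else if Suc s = t then lam t else if s = Suc t then 1 else 0)"

lemma tridiag_step_weight:
  assumes "motzkin_step p q"
  shows "tridiag b lam (snd p) (snd q) = step_weight b lam p q"
  using assms by (auto simp: motzkin_step_def tridiag_def step_weight_def)

lemma tridiag_eq_0:
  assumes "\<not> motzkin_step (x, t) (x + 1, s)"
  shows "tridiag b lam t s = 0"
  using assms by (auto simp: motzkin_step_def tridiag_def)

lemma path_weight_snoc:
  assumes "ps \<noteq> []"
  shows "path_weight b lam (ps @ [q]) = path_weight b lam ps * step_weight b lam (last ps) q"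
proof -
  obtain m where m: "length ps = Suc m"
    using assms by (cases ps) auto
  have "path_weight b lam (ps @ [q]) =
      (\<Prod>i<m. step_weight b lam ((ps @ [q]) ! i) ((ps @ [q]) ! Suc i)) *
      step_weight b lam ((ps @ [q]) ! m) ((ps @ [q]) ! Suc m)"
    by (simp add: path_weight_def m)
  also have "(\<Prod>i<m. step_weight b lam ((ps @ [q]) ! i) ((ps @ [q]) ! Suc i)) =
      path_weight b lam ps"
    unfolding path_weight_def by (rule prod.cong) (auto simp: m nth_append)
  finally show ?thesis
    using assms by (simp add: m nth_append last_conv_nth)
qed

lemma bounded_motzkin_paths_Suc:
  "bounded_motzkin_paths K (Suc N) r s =
     (if s \<le> K then \<Union>t\<in>{t. t \<le> K \<and> motzkin_step (int N, t) (int (Suc N), s)}.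
        (\<lambda>ps. ps @ [(int (Suc N), s)]) ` bounded_motzkin_paths K N r t
      else {})" (is "?L = ?R")
proof (intro equalityI subsetI)
  fix ps assume "ps \<in> ?L"
  then have ps: "ps \<noteq> []" "successively motzkin_step ps" "hd ps = (0, r)"
      "last ps = (int (Suc N), s)" "\<forall>p\<in>set ps. snd p \<le> K"
    by (auto simp: bounded_motzkin_paths_def motzkin_path_def)
  define qs where "qs = butlast ps"
  have eq: "ps = qs @ [(int (Suc N), s)]"
    using ps by (metis qs_def append_butlast_last_id)
  have qs: "qs \<noteq> []" using ps eq by auto
  have step: "motzkin_step (last qs) (int (Suc N), s)" and succ: "successively motzkin_step qs"
    using ps(2) qs unfolding eq by (auto simp: successively_append_iff)
  have last: "last qs = (int N, snd (last qs))"
    using step by (auto simp: motzkin_step_def prod_eq_iff)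
  have "snd (last qs) \<le> K" "s \<le> K"
    using ps(5) qs unfolding eq by auto
  moreover have "qs \<in> bounded_motzkin_paths K N r (snd (last qs))"
    using ps qs succ last unfolding eq by (auto simp: bounded_motzkin_paths_def motzkin_path_def)
  ultimately show "ps \<in> ?R"
    using step last eq by auto
next
  fix ps assume "ps \<in> ?R"
  then show "ps \<in> ?L"
    by (auto split: if_splits
        simp: bounded_motzkin_paths_def motzkin_path_def successively_append_iff)
qed

lemma bounded_motzkin_paths_0:
  "bounded_motzkin_paths K 0 r s = (if r = s \<and> r \<le> K then {[(0, r)]} else {})"
proof -
  have "ps = [(0, r)]"
    if "successively motzkin_step ps" "ps \<noteq> []" "hd ps = (0, r)" "last ps = (0, s)" for ps
  proof (cases ps rule: rev_cases)
    case (snoc qs q)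
    \<comment> \<open>Every step advances the x-coordinate by exactly one, so a path that starts and
      ends at x-coordinate 0 is a single point.\<close>
    have "fst (hd ps) + int (length ps - 1) = fst (last ps)"
      using that(1,2)
    proof (induction ps)
      case (Cons p ps)
      then show ?case by (cases ps) (auto simp: motzkin_step_def)
    qed simp
    then show ?thesis
      using that snoc by (cases qs) auto
  qed (use that in simp)
  then have "bounded_motzkin_paths K 0 r s \<subseteq> {[(0, r)]}"
    by (auto simp: bounded_motzkin_paths_def motzkin_path_def)
  moreover have "[(0, r)] \<in> bounded_motzkin_paths K 0 r s \<longleftrightarrow> r = s \<and> r \<le> K"
    by (auto simp: bounded_motzkin_paths_def motzkin_path_def)
  ultimately show ?thesis by auto
qed

lemma finite_bounded_motzkin_paths: "finite (bounded_motzkin_paths K N r s)"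
  by (induction N arbitrary: s) (auto simp: bounded_motzkin_paths_0 bounded_motzkin_paths_Suc)

lemma motzkin_mu_0: "motzkin_mu b lam K 0 r s = (if r = s \<and> r \<le> K then 1 else 0)"
  by (simp add: motzkin_mu_def bounded_motzkin_paths_0 path_weight_def)

lemma motzkin_mu_above:
  assumes "K < r"
  shows "motzkin_mu b lam K N r s = 0"
proof -
  have "bounded_motzkin_paths K N r s = {}"
    using assms hd_in_set by (force simp: bounded_motzkin_paths_def motzkin_path_def)
  then show ?thesis by (simp add: motzkin_mu_def)
qed

lemma motzkin_mu_Suc_last:
  assumes "s \<le> K"
  shows "motzkin_mu b lam K (Suc N) r s = (\<Sum>t\<le>K. motzkin_mu b lam K N r t * tridiag b lam t s)"
proof -
  define T where "T = {t. t \<le> K \<and> motzkin_step (int N, t) (int (Suc N), s)}"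
  let ?q = "(int (Suc N), s)"
  have T: "T \<subseteq> {..K}" "finite T"
    by (auto simp: T_def intro: finite_subset[of _ "{..K}"])
  \<comment> \<open>The blocks for different \<open>t\<close> are disjoint, because the next-to-last
    point of the extended path is \<open>(int N, t)\<close>.\<close>
  have "motzkin_mu b lam K (Suc N) r s =
      (\<Sum>t\<in>T. \<Sum>ps\<in>(\<lambda>ps. ps @ [?q]) ` bounded_motzkin_paths K N r t. path_weight b lam ps)"
    unfolding motzkin_mu_def bounded_motzkin_paths_Suc T_def[symmetric] using assms T
    by (simp, subst sum.UNION_disjoint)
      (auto simp: finite_bounded_motzkin_paths, auto simp: bounded_motzkin_paths_def)
  also have "\<dots> = (\<Sum>t\<in>T. \<Sum>ps\<in>bounded_motzkin_paths K N r t. path_weight b lam (ps @ [?q]))"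
    by (subst sum.reindex) (auto simp: inj_on_def)
  also have "\<dots> = (\<Sum>t\<in>T. \<Sum>ps\<in>bounded_motzkin_paths K N r t.
      path_weight b lam ps * tridiag b lam t s)"
  proof (intro sum.cong refl)
    fix t ps assume "t \<in> T" "ps \<in> bounded_motzkin_paths K N r t"
    then show "path_weight b lam (ps @ [?q]) = path_weight b lam ps * tridiag b lam t s"
      using tridiag_step_weight[of "(int N, t)" ?q b lam]
      by (auto simp: T_def bounded_motzkin_paths_def motzkin_path_def path_weight_snoc)
  qed
  also have "\<dots> = (\<Sum>t\<in>T. motzkin_mu b lam K N r t * tridiag b lam t s)"
    by (simp add: motzkin_mu_def sum_distrib_right)
  also have "\<dots> = (\<Sum>t\<le>K. motzkin_mu b lam K N r t * tridiag b lam t s)"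
    using T tridiag_eq_0[of "int N" _ s b lam]
    by (intro sum.mono_neutral_left) (auto simp: T_def add.commute)
  finally show ?thesis .
qed

text \<open>This is A^N A = A A^N, derived from the last-step version by induction on
  \<open>N\<close>; a direct bijection on paths would have to shift x-coordinates. The first-step
  form is the one needed later, where \<open>s\<close> is fixed and the relation links neighbouring
  starting heights.\<close>

lemma motzkin_mu_Suc_first:
  assumes "r \<le> K" "s \<le> K"
  shows "motzkin_mu b lam K (Suc N) r s = (\<Sum>t\<le>K. tridiag b lam r t * motzkin_mu b lam K N t s)"
  using assms(2)
proof (induction N arbitrary: s)
  case 0
  then show ?case
    using assms by (simp add: motzkin_mu_Suc_last motzkin_mu_0 if_distrib if_distribR sum.delta
        sum.delta' cong: if_cong)
next
  case (Suc N)
  have "motzkin_mu b lam K (Suc (Suc N)) r s =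
      (\<Sum>t\<le>K. \<Sum>u\<le>K. tridiag b lam r u * (motzkin_mu b lam K N u t * tridiag b lam t s))"
    unfolding motzkin_mu_Suc_last[OF Suc.prems, of _ _ "Suc N"]
    by (intro sum.cong refl) (simp add: Suc.IH sum_distrib_right mult.assoc)
  also have "\<dots> = (\<Sum>u\<le>K. tridiag b lam r u * motzkin_mu b lam K (Suc N) u s)"
    by (subst sum.swap) (simp add: motzkin_mu_Suc_last[OF Suc.prems] sum_distrib_left)
  finally show ?case .
qed

lemma sum_tridiag:
  assumes "r \<le> K" "f (Suc K) = 0"
  shows "(\<Sum>t\<le>K. tridiag b lam r t * f t) =
    f (Suc r) + b r * f r + (if r = 0 then 0 else lam r * f (r - 1))"
proof -
  \<comment> \<open>Adding the vanishing term at \<open>Suc K\<close> brings the superdiagonal index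
    \<open>Suc r\<close> into range also for \<open>r = K\<close>.\<close>
  have "(\<Sum>t\<le>K. tridiag b lam r t * f t) = (\<Sum>t\<le>Suc K. tridiag b lam r t * f t)"
    using assms by simp
  also have "\<dots> = (\<Sum>t\<le>Suc K. (if t = Suc r then f t else 0) + (if t = r then b r * f t else 0) +
      (if r \<noteq> 0 \<and> t = r - 1 then lam r * f t else 0))"
    by (intro sum.cong refl) (auto simp: tridiag_def)
  also have "\<dots> = f (Suc r) + b r * f r + (if r = 0 then 0 else lam r * f (r - 1))"
    using assms(1) by (auto simp: sum.distrib simp del: sum.atMost_Suc)
  finally show ?thesis .
qed

section \<open>The recurrence given by the orthogonal polynomial\<close>

text \<open>The polynomial \<open>p\<close> applied to the shift operator \<open>f \<mapsto> (\<lambda>N. f (N + 1))\<close>.\<close>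

definition shift_poly :: "'a::comm_ring_1 poly \<Rightarrow> (int \<Rightarrow> 'a) \<Rightarrow> int \<Rightarrow> 'a" where
  "shift_poly p f N = (\<Sum>j\<le>degree p. coeff p j * f (N + int j))"

lemma shift_poly_upto:
  assumes "degree p \<le> D"
  shows "shift_poly p f N = (\<Sum>j\<le>D. coeff p j * f (N + int j))"
  unfolding shift_poly_def using assms
  by (intro sum.mono_neutral_left) (auto simp: coeff_eq_0)

lemma shift_poly_1: "shift_poly 1 f N = f N"
  by (simp add: shift_poly_def)

lemma shift_poly_diff: "shift_poly (p - q) f N = shift_poly p f N - shift_poly q f N"
proof -
  let ?D = "max (degree p) (degree q)"
  have "degree (p - q) \<le> ?D" by (rule degree_diff_le_max)
  then show ?thesis
    by (simp add: shift_poly_upto[of _ ?D] algebra_simps sum_subtractf)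
qed

lemma shift_poly_smult: "shift_poly (smult c p) f N = c * shift_poly p f N"
  using shift_poly_upto[OF degree_smult_le[of c p]]
  by (simp add: shift_poly_def sum_distrib_left mult.assoc)

lemma shift_poly_pCons: "shift_poly (pCons c p) f N = c * f N + shift_poly p f (N + 1)"
proof -
  have "shift_poly (pCons c p) f N = (\<Sum>j\<le>Suc (degree p). coeff (pCons c p) j * f (N + int j))"
    by (rule shift_poly_upto) (rule degree_pCons_le)
  also have "\<dots> = c * f N + (\<Sum>j\<le>degree p. coeff p j * f (N + int (Suc j)))"
    by (subst sum.atMost_Suc_shift) simp
  finally show ?thesis by (simp add: shift_poly_def add_ac)
qed

text \<open>These are the characteristic polynomials of the leading blocks of the tridiagonal
  matrix, generated by their three-term recurrence; \<open>pCons 0\<close> is multiplication by the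
  variable.\<close>

fun orth_poly :: "(nat \<Rightarrow> 'a::comm_ring_1) \<Rightarrow> (nat \<Rightarrow> 'a) \<Rightarrow> nat \<Rightarrow> 'a poly" where
  "orth_poly b lam 0 = 1"
| "orth_poly b lam (Suc 0) = [:- b 0, 1:]"
| "orth_poly b lam (Suc (Suc n)) =
     pCons 0 (orth_poly b lam (Suc n)) - smult (b (Suc n)) (orth_poly b lam (Suc n)) -
     smult (lam (Suc n)) (orth_poly b lam n)"

lemma orth_poly_monic: "degree (orth_poly b lam n) \<le> n \<and> coeff (orth_poly b lam n) n = 1"
proof (induction b lam n rule: orth_poly.induct)
  case (3 b lam n)
  let ?p = "orth_poly b lam (Suc n)" and ?q = "orth_poly b lam n"
  have "degree (pCons 0 ?p) \<le> Suc (Suc n)"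
    by (rule order.trans[OF degree_pCons_le]) (use 3 in simp)
  moreover have "degree (smult (b (Suc n)) ?p) \<le> Suc (Suc n)"
    by (rule order.trans[OF degree_smult_le]) (use 3 in simp)
  moreover have "degree (smult (lam (Suc n)) ?q) \<le> Suc (Suc n)"
    by (rule order.trans[OF degree_smult_le]) (use 3 in simp)
  ultimately show ?case
    using 3 by (auto intro!: degree_diff_le simp: coeff_eq_0)
qed auto

text \<open>Solved for \<open>g N (Suc r)\<close>, the row relation is the recurrence of
  \<open>orth_poly\<close> with the shift in \<open>N\<close> as the variable. Hence row 0 generates
  all rows up to \<open>Suc K\<close>.\<close>

lemma shift_poly_orth_poly:
  assumes rec: "\<And>N r. r \<le> K \<Longrightarrow>
      g (N + 1) r = g N (Suc r) + b r * g N r + (if r = 0 then 0 else lam r * g N (r - 1))"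
    and "i \<le> Suc K"
  shows "shift_poly (orth_poly b lam i) (\<lambda>N. g N 0) N = g N i"
  using assms
proof (induction b lam i arbitrary: N rule: orth_poly.induct)
  case (2 b lam)
  then show ?case using 2(1)[of 0 N] by (simp add: shift_poly_pCons shift_poly_def)
next
  case (3 b lam n)
  then show ?case
    by (simp add: shift_poly_diff shift_poly_smult shift_poly_pCons)
qed (simp add: shift_poly_1)

text \<open>On row 0 the polynomial produces row \<open>Suc K\<close>, which is zero. A higher row
  is a combination of shifts of the two rows below it, and polynomials in the shift commute with
  such combinations.\<close>

lemma shift_poly_orth_poly_eq_0:
  assumes rec: "\<And>N r. r \<le> K \<Longrightarrow>
      g (N + 1) r = g N (Suc r) + b r * g N r + (if r = 0 then 0 else lam r * g N (r - 1))"
    and top: "\<And>N. g N (Suc K) = 0" and "r \<le> K"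
  shows "shift_poly (orth_poly b lam (Suc K)) (\<lambda>N. g N r) N = 0"
  using \<open>r \<le> K\<close>
proof (induction r arbitrary: N rule: less_induct)
  case (less r)
  let ?S = "\<lambda>i. shift_poly (orth_poly b lam (Suc K)) (\<lambda>N. g N i)"
  show ?case
  proof (cases r)
    case 0
    then show ?thesis
      using shift_poly_orth_poly[where g = g and b = b and lam = lam and K = K and i = "Suc K"]
        rec top by simp
  next
    case (Suc q)
    let ?h = "\<lambda>N. g (N + 1) q - b q * g N q - (if q = 0 then 0 else lam q * g N (q - 1))"
    have "g N (Suc q) = ?h N" for N
      using rec[of q N] less.prems Suc by (simp add: algebra_simps)
    then have "?S r N = shift_poly (orth_poly b lam (Suc K)) ?h N"
      using Suc by simp
    also have "\<dots> = ?S q (N + 1) - b q * ?S q N - (if q = 0 then 0 else lam q * ?S (q - 1) N)"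
      by (simp add: shift_poly_def sum_subtractf sum.distrib sum_distrib_left algebra_simps)
    also have "\<dots> = 0"
      using less Suc by simp
    finally show ?thesis .
  qed
qed

lemma recurrence_extends_orth_poly:
  fixes g :: "int \<Rightarrow> nat \<Rightarrow> 'a::field"
  assumes rec: "\<And>N r. r \<le> K \<Longrightarrow>
      g (N + 1) r = g N (Suc r) + b r * g N r + (if r = 0 then 0 else lam r * g N (r - 1))"
    and top: "\<And>N. g N (Suc K) = 0" and "r \<le> K"
    and nz: "coeff (orth_poly b lam (Suc K)) 0 \<noteq> 0"
  shows "recurrence_extends (\<lambda>N. g (int N) r) (\<lambda>N. g N r)"
proof -
  let ?p = "orth_poly b lam (Suc K)"
  \<comment> \<open>The polynomial is monic of degree \<open>Suc K\<close>, so its annihilation of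
    \<open>g\<close> can be solved for the top term. The last coefficient \<open>c (Suc K)\<close>
    is minus the constant coefficient, which is nonzero by \<open>nz\<close>.\<close>
  define c where "c i = - coeff ?p (Suc K - i)" for i
  have *: "g N r = (\<Sum>i=1..Suc K. c i * g (N - int i) r)" for N
  proof -
    have "0 = (\<Sum>j\<le>Suc K. coeff ?p j * g (N - int (Suc K) + int j) r)"
      using shift_poly_orth_poly_eq_0[where g = g and b = b and lam = lam and K = K and r = r
          and N = "N - int (Suc K)"] rec top \<open>r \<le> K\<close>
        shift_poly_upto[of ?p "Suc K"] orth_poly_monic[of b lam "Suc K"] by simp
    also have "\<dots> = g N r + (\<Sum>j<Suc K. coeff ?p j * g (N - int (Suc K) + int j) r)"
      using orth_poly_monic[of b lam "Suc K"]
      by (simp only: lessThan_Suc_atMost[symmetric] sum.lessThan_Suc[of _ "Suc K"]) simp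
    also have "(\<Sum>j<Suc K. coeff ?p j * g (N - int (Suc K) + int j) r) =
        (\<Sum>i=1..Suc K. - c i * g (N - int i) r)"
      by (rule sum.reindex_bij_witness[of _ "\<lambda>i. Suc K - i" "\<lambda>j. Suc K - j"])
        (auto simp: c_def of_nat_diff algebra_simps)
    finally show ?thesis
      unfolding mult_minus_left sum_negf by (metis add_eq_0_iff add.inverse_inverse)
  qed
  show ?thesis
    unfolding recurrence_extends_def
  proof (intro exI[of _ "Suc K"] exI[of _ c] conjI allI impI)
    fix N assume "Suc K \<le> N"
    then show "g (int N) r = (\<Sum>i=1..Suc K. c i * g (int (N - i)) r)"
      by (subst *) (intro sum.cong refl, simp add: of_nat_diff)
  next
    show "g N r = (\<Sum>i=1..Suc K. c i * g (N - int i) r)" for N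
      by (rule *)
  qed (use nz in \<open>simp_all add: c_def\<close>)
qed

section \<open>The inverse matrix and peak-valley sequences\<close>

definition pv_rel :: "nat \<Rightarrow> nat \<Rightarrow> bool" where
  "pv_rel x y \<longleftrightarrow> (x mod 3 = 0 \<longrightarrow> x < y) \<and> (x mod 3 = 2 \<longrightarrow> y < x) \<and>
     (y mod 3 = 0 \<longrightarrow> y < x) \<and> (y mod 3 = 2 \<longrightarrow> x < y)"

text \<open>Each condition compares an entry with one neighbour, so the conditions can be regrouped
  by consecutive pairs; the ignored inequalities at the ends belong to no pair.\<close>

lemma peak_valley3_iff: "peak_valley3 r s as \<longleftrightarrow> successively pv_rel (r # as @ [s])"
proof -
  define a where "a i = (r # as @ [s]) ! i" for i
  define N where "N = length as"
  have "(\<forall>i\<le>N + 1.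
        (a i mod 3 = 0 \<longrightarrow>
           (i \<ge> 1 \<longrightarrow> a (i - 1) > a i) \<and> (i \<le> N \<longrightarrow> a i < a (i + 1))) \<and>
        (a i mod 3 = 2 \<longrightarrow>
           (i \<ge> 1 \<longrightarrow> a (i - 1) < a i) \<and> (i \<le> N \<longrightarrow> a i > a (i + 1)))) \<longleftrightarrow>
    (\<forall>i\<le>N. pv_rel (a i) (a (Suc i)))" (is "?L \<longleftrightarrow> ?R")
  proof
    assume L: ?L
    show ?R
    proof (intro allI impI)
      fix i assume "i \<le> N"
      then show "pv_rel (a i) (a (Suc i))"
        using L[rule_format, of i] L[rule_format, of "Suc i"] by (auto simp: pv_rel_def)
    qed
  next
    assume R: ?R
    show ?L
    proof (intro allI impI)
      fix i assume "i \<le> N + 1"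
      then show "(a i mod 3 = 0 \<longrightarrow>
           (i \<ge> 1 \<longrightarrow> a (i - 1) > a i) \<and> (i \<le> N \<longrightarrow> a i < a (i + 1))) \<and>
        (a i mod 3 = 2 \<longrightarrow>
           (i \<ge> 1 \<longrightarrow> a (i - 1) < a i) \<and> (i \<le> N \<longrightarrow> a i > a (i + 1)))"
        using R[rule_format, of i] R[rule_format, of "i - 1"]
        by (cases i) (auto simp: pv_rel_def)
    qed
  qed
  then show ?thesis
    unfolding peak_valley3_def Let_def a_def N_def successively_conv_nth
    by (simp add: less_Suc_eq_le)
qed

lemma PV3_0: "PV3 K 0 r s = (if pv_rel r s then {[]} else {})"
  by (auto simp: PV3_def peak_valley3_iff)

lemma PV3_Suc: "PV3 K (Suc N) r s = (\<Union>x\<in>{x. x \<le> K \<and> pv_rel r x}. (#) x ` PV3 K N x s)"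
  by (auto simp: PV3_def peak_valley3_iff length_Suc_conv)

lemma finite_PV3: "finite (PV3 K N r s)"
  by (induction N arbitrary: r) (simp_all add: PV3_0 PV3_Suc)

definition pv_sum :: "(nat \<Rightarrow> 'a::comm_semiring_1) \<Rightarrow> nat \<Rightarrow> nat \<Rightarrow> nat \<Rightarrow> nat \<Rightarrow> 'a" where
  "pv_sum V K N r s = (\<Sum>as\<in>PV3 K N r s. seq_weight V as)"

lemma pv_sum_0: "pv_sum V K 0 r s = (if pv_rel r s then 1 else 0)"
  by (simp add: pv_sum_def PV3_0 seq_weight_def)

lemma pv_sum_Suc:
  "pv_sum V K (Suc N) r s = (\<Sum>x\<le>K. (if pv_rel r x then 1 else 0) * (V x * pv_sum V K N x s))"
proof -
  let ?X = "{x. x \<le> K \<and> pv_rel r x}"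
  have "pv_sum V K (Suc N) r s = (\<Sum>x\<in>?X. \<Sum>as\<in>(#) x ` PV3 K N x s. seq_weight V as)"
    unfolding pv_sum_def PV3_Suc by (rule sum.UNION_disjoint) (auto simp: finite_PV3)
  also have "\<dots> = (\<Sum>x\<in>?X. V x * pv_sum V K N x s)"
    by (subst sum.reindex) (auto simp: pv_sum_def seq_weight_def sum_distrib_left)
  also have "\<dots> = (\<Sum>x\<le>K. (if pv_rel r x then 1 else 0) * (V x * pv_sum V K N x s))"
    by (rule sum.mono_neutral_cong_left) auto
  finally show ?thesis .
qed

text \<open>This is \<open>A\<^sup>-\<^sup>1\<close> up to the diagonal scaling on the left and right. Row \<open>3 * k\<close> vanishes on the
  columns below \<open>3 * k\<close>, so the upper boundary of the strip needs no special treatment.\<close>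

definition pv_sign :: "nat \<Rightarrow> nat \<Rightarrow> 'a::comm_ring_1" where
  "pv_sign x y = (if pv_rel x y then (-1) ^ (x div 3) else 0)"

lemma div_mod_3:
  fixes x :: nat
  shows "(3 * x) mod 3 = 0" "(3 * x + 1) mod 3 = 1" "(3 * x + 2) mod 3 = 2"
    "(3 * x) div 3 = x" "(3 * x + 1) div 3 = x" "(3 * x + 2) div 3 = x"
  by presburger+

lemma less_mult_3:
  fixes x y :: nat
  shows "3 * x < 3 * y + 1 \<longleftrightarrow> x \<le> y" "3 * x < 3 * y + 2 \<longleftrightarrow> x \<le> y"
    "3 * x + 1 < 3 * y + 2 \<longleftrightarrow> x \<le> y"
  by presburger+

text \<open>Residue 1 imposes no inequality, whereas two residues 0, or two residues 2, impose
  contradictory ones. In the other cases only the quotients have to be compared.\<close>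

lemma pv_sign_residues:
  fixes q t :: nat
  shows "pv_sign (3 * q) (3 * t) = 0"
    "pv_sign (3 * q) (3 * t + 1) = (if q \<le> t then (-1) ^ q else 0)"
    "pv_sign (3 * q) (3 * t + 2) = (if q \<le> t then (-1) ^ q else 0)"
    "pv_sign (3 * q + 1) (3 * t) = (if t \<le> q then (-1) ^ q else 0)"
    "pv_sign (3 * q + 1) (3 * t + 1) = (-1) ^ q"
    "pv_sign (3 * q + 1) (3 * t + 2) = (if q \<le> t then (-1) ^ q else 0)"
    "pv_sign (3 * q + 2) (3 * t) = (if t \<le> q then (-1) ^ q else 0)"
    "pv_sign (3 * q + 2) (3 * t + 1) = (if t \<le> q then (-1) ^ q else 0)"
    "pv_sign (3 * q + 2) (3 * t + 2) = 0"
  unfolding pv_sign_def pv_rel_def div_mod_3 less_mult_3 by auto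

lemma mod_3_cases:
  fixes x :: nat
  obtains q where "x = 3 * q" | q where "x = 3 * q + 1" | q where "x = 3 * q + 2"
proof -
  have "\<exists>q. x = 3 * q \<or> x = 3 * q + 1 \<or> x = 3 * q + 2"
    by presburger
  then show ?thesis using that by blast
qed

text \<open>Solutions of f(r+1) - f(r) + f(r-1) = 0 satisfy f(r+3) = -f(r), which matches the sign.
  For fixed \<open>s\<close>, the column is one such solution up to row \<open>s\<close>, with value
  0 at row -1, and another from row \<open>s\<close> on, vanishing at multiples of 3. They are glued
  at \<open>s\<close> with a jump of (-1)^(s div 3).\<close>

lemma pv_sign_second_difference:
  "pv_sign (Suc r) s - pv_sign r s + (if r = 0 then 0 else pv_sign (r - 1) s) =
    (if r = s then (-1) ^ (r div 3) else (0::'a::comm_ring_1))"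
proof -
  have neighbours: "Suc (3 * x) = 3 * x + 1" "Suc (3 * x + 1) = 3 * x + 2"
      "Suc (3 * x + 2) = 3 * Suc x" "3 * x + 1 - 1 = 3 * x" "3 * x + 2 - 1 = 3 * x + 1"
      "3 * Suc x - 1 = 3 * x + 2" for x :: nat
    by auto
  have eqs: "3 * x + 1 = 0 \<longleftrightarrow> False" "3 * x + 2 = 0 \<longleftrightarrow> False" "3 * Suc x = 0 \<longleftrightarrow> False"
      "3 * x = 3 * y \<longleftrightarrow> x = y" "3 * x = 3 * y + 1 \<longleftrightarrow> False" "3 * x = 3 * y + 2 \<longleftrightarrow> False"
      "3 * x + 1 = 3 * y \<longleftrightarrow> False" "3 * x + 1 = 3 * y + 1 \<longleftrightarrow> x = y" "3 * x + 1 = 3 * y + 2 \<longleftrightarrow> False"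
      "3 * x + 2 = 3 * y \<longleftrightarrow> False" "3 * x + 2 = 3 * y + 1 \<longleftrightarrow> False" "3 * x + 2 = 3 * y + 2 \<longleftrightarrow> x = y"
    for x y :: nat
    by presburger+
  note simps = neighbours eqs div_mod_3 pv_sign_residues if_False
  show ?thesis
  proof (cases r rule: mod_3_cases)
    case r: (1 q)
    show ?thesis
    \<comment> \<open>The row before \<open>3 * q\<close> lies in the preceding block of three, so
      \<open>q\<close> is written as a successor unless the row is 0.\<close>
    proof (cases q)
      case 0
      have "pv_sign (Suc (3 * 0)) s - pv_sign (3 * 0) s =
          (if 3 * 0 = s then (-1) ^ (3 * 0 div 3) else (0::'a))"
        by (cases s rule: mod_3_cases; simp only: simps; auto)
      then show ?thesis
        using r 0 by simp
    next
      case (Suc p)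
      show ?thesis
        unfolding r Suc by (cases s rule: mod_3_cases; simp only: simps; auto)
    qed
  next
    case r: (2 q)
    show ?thesis
      unfolding r by (cases s rule: mod_3_cases; simp only: simps; auto)
  next
    case r: (3 q)
    show ?thesis
      unfolding r by (cases s rule: mod_3_cases; simp only: simps; auto)
  qed
qed

lemma pv_rel_top:
  assumes "x \<le> K" "Suc K = 3 * k"
  shows "\<not> pv_rel (Suc K) x"
  using assms by (simp add: pv_rel_def)

lemma pv_sum_top:
  assumes "s \<le> K" "Suc K = 3 * k"
  shows "pv_sum V K N (Suc K) s = 0"
  using pv_rel_top[OF _ assms(2)] assms(1) by (cases N) (simp_all add: pv_sum_0 pv_sum_Suc)

text \<open>Summing over the first interior entry \<open>y\<close>, the Green function identity
  leaves only \<open>y = r\<close>, whose weight is the factor \<open>V r\<close>.\<close>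

lemma pv_sum_second_difference:
  fixes V :: "nat \<Rightarrow> 'a::comm_ring_1"
  assumes "r \<le> K"
  defines "w \<equiv> \<lambda>N x s. (-1) ^ (x div 3) * pv_sum V K N x s"
  shows "w (Suc N) (Suc r) s - w (Suc N) r s + (if r = 0 then 0 else w (Suc N) (r - 1) s) =
    V r * w N r s"
proof -
  have w: "w (Suc N) x s = (\<Sum>y\<le>K. pv_sign x y * (V y * pv_sum V K N y s))" for x
    unfolding w_def pv_sum_Suc sum_distrib_left
    by (intro sum.cong refl) (simp add: pv_sign_def)
  have "w (Suc N) (Suc r) s - w (Suc N) r s + (if r = 0 then 0 else w (Suc N) (r - 1) s) =
      (\<Sum>y\<le>K. (pv_sign (Suc r) y - pv_sign r y + (if r = 0 then 0 else pv_sign (r - 1) y)) *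
        (V y * pv_sum V K N y s))"
    unfolding w by (simp add: algebra_simps sum.distrib sum_subtractf)
  also have "\<dots> = (\<Sum>y\<le>K. if y = r then V r * w N r s else 0)"
    unfolding pv_sign_second_difference by (intro sum.cong refl) (auto simp: w_def)
  also have "\<dots> = V r * w N r s"
    using assms(1) by simp
  finally show ?thesis .
qed

text \<open>Up to sign this coefficient is the determinant of the matrix of size
  \<open>3 * k\<close>. The divisibility by 3 matters: the scaled value \<open>q 2\<close> is
  0.\<close>

lemma coeff_0_orth_poly:
  fixes V :: "nat \<Rightarrow> 'a::field"
  assumes V: "\<And>i. V i \<noteq> 0"
  defines "p \<equiv> orth_poly (\<lambda>i. - inverse (V i)) (\<lambda>i. inverse (V i) * inverse (V (i - 1)))"
  shows "coeff (p (3 * k)) 0 \<noteq> 0"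
proof -
  define q where "q n = (\<Prod>i<n. V i) * coeff (p n) 0" for n
  have q_Suc: "q (Suc (Suc n)) = q (Suc n) - q n" for n
    using V by (simp add: q_def p_def field_simps)
  have q_3: "q (Suc (Suc (Suc n))) = - q n" for n
    by (simp add: q_Suc)
  have "q (3 * k) = (-1) ^ k"
  proof (induction k)
    case 0
    show ?case by (simp add: q_def p_def)
  next
    case (Suc k)
    then show ?case using q_3[of "3 * k"] by (simp add: numeral_3_eq_3)
  qed
  then show ?thesis by (auto simp: q_def)
qed

section \<open>The two-sided sequence of matrix powers\<close>

text \<open>For fixed \<open>s\<close>, this is column \<open>s\<close> of the \<open>N\<close>-th
  matrix power. The row comes last, so that \<open>g N\<close> is the vector on which the matrix
  acts; exponent -n corresponds to n - 1 interior entries.\<close>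

definition two_sided_power ::
  "(nat \<Rightarrow> 'a::field) \<Rightarrow> (nat \<Rightarrow> 'a) \<Rightarrow> (nat \<Rightarrow> 'a) \<Rightarrow> nat \<Rightarrow> nat \<Rightarrow> int \<Rightarrow> nat \<Rightarrow> 'a" where
  "two_sided_power V b lam K s N r =
     (if N \<ge> 0 then motzkin_mu b lam K (nat N) r s
      else (-1) ^ (r div 3 + s div 3) * ((\<Prod>i\<le>s. V i) / (\<Prod>i<r. V i)) *
        pv_sum V K (nat (- N - 1)) r s)"

lemma two_sided_power_of_nat [simp]:
  "two_sided_power V b lam K s (int N) r = motzkin_mu b lam K N r s"
  by (simp add: two_sided_power_def)

lemma two_sided_power_neg:
  "two_sided_power V b lam K s (- int (Suc N)) r =
     ((-1) ^ (s div 3) * (\<Prod>i\<le>s. V i)) * ((-1) ^ (r div 3) * pv_sum V K N r s) / (\<Prod>i<r. V i)"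
  by (simp add: two_sided_power_def power_add)

lemma two_sided_power_top:
  assumes "s \<le> K" "Suc K = 3 * k"
  shows "two_sided_power V b lam K s N (Suc K) = 0"
  unfolding two_sided_power_def pv_sum_top[OF assms] by (simp add: motzkin_mu_above)

text \<open>This is row \<open>r\<close> of A A^N = A^(N+1). Nonnegative \<open>N\<close> is the
  first-step decomposition, \<open>N = -1\<close> says that the Green function inverts the matrix,
  and smaller \<open>N\<close> removes one factor of the inverse.\<close>

lemma two_sided_power_rec:
  fixes V :: "nat \<Rightarrow> 'a::field"
  assumes V: "\<And>i. V i \<noteq> 0" and K: "r \<le> K" "s \<le> K" "Suc K = 3 * k"
  defines "b \<equiv> \<lambda>i. - inverse (V i)" and "lam \<equiv> \<lambda>i. inverse (V i) * inverse (V (i - 1))"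
  defines "g \<equiv> two_sided_power V b lam K s"
  shows "g (N + 1) r = g N (Suc r) + b r * g N r + (if r = 0 then 0 else lam r * g N (r - 1))"
proof (cases "N \<ge> 0")
  case True
  then obtain M where "N = int M"
    using nonneg_int_cases by blast
  then have "g N = (\<lambda>r. motzkin_mu b lam K M r s)" "g (N + 1) r = motzkin_mu b lam K (Suc M) r s"
    unfolding g_def using two_sided_power_of_nat[of V b lam K s "Suc M" r]
    by (auto simp: add.commute)
  then show ?thesis
    using K by (simp add: motzkin_mu_Suc_first sum_tridiag motzkin_mu_above)
next
  case False
  define M where "M = nat (- N - 1)"
  have N: "N = - int (Suc M)"
    using False by (simp add: M_def)
  define w where "w n x = (-1) ^ (x div 3) * pv_sum V K n x s" for n x
  define C where "C = (-1) ^ (s div 3) * (\<Prod>i\<le>s. V i)"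
  define P where "P r = (\<Prod>i<r. V i)" for r
  have P: "P (Suc r) = P r * V r" "P r \<noteq> 0" for r
    using V by (auto simp: P_def)
  have gN: "g N r = C * w M r / P r" for r
    unfolding g_def N two_sided_power_neg C_def w_def P_def by simp
  \<comment> \<open>Scaling by \<open>P\<close> absorbs the factors V in \<open>b\<close> and
    \<open>lam\<close>, leaving coefficients 1, -1, 1 and the common denominator
    \<open>P (Suc r)\<close>.\<close>
  have "g N (Suc r) + b r * g N r + (if r = 0 then 0 else lam r * g N (r - 1)) =
      C / P (Suc r) * (w M (Suc r) - w M r + (if r = 0 then 0 else w M (r - 1)))"
    using V P by (cases r) (simp_all add: gN b_def lam_def field_simps)
  also have "\<dots> = g (N + 1) r"
  proof (cases M)
    case 0
    have "w 0 x = pv_sign x s" for x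
      by (simp add: w_def pv_sign_def pv_sum_0)
    then have "C / P (Suc r) * (w M (Suc r) - w M r + (if r = 0 then 0 else w M (r - 1))) =
        C / P (Suc r) * (if r = s then (-1) ^ (r div 3) else 0)"
      by (simp only: 0 pv_sign_second_difference)
    \<comment> \<open>For \<open>r = s\<close> the numerator \<open>C\<close> is the sign times
      \<open>P (Suc s)\<close>, and the two equal signs cancel.\<close>
    also have "\<dots> = (if r = s then 1 else 0)"
      using P(2)[of "Suc r"]
      by (auto simp: C_def P_def lessThan_Suc_atMost simp flip: power_add mult_2)
    also have "\<dots> = g (N + 1) r"
      using K 0 N by (simp add: g_def two_sided_power_def motzkin_mu_0)
    finally show ?thesis .
  next
    case (Suc n)
    have "w (Suc n) (Suc r) - w (Suc n) r + (if r = 0 then 0 else w (Suc n) (r - 1)) = V r * w n r"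
      unfolding w_def by (rule pv_sum_second_difference) fact
    moreover have "g (N + 1) r = C * w n r / P r"
      unfolding g_def N Suc C_def w_def P_def
      using two_sided_power_neg[of V b lam K s n r] by (simp add: algebra_simps)
    ultimately show ?thesis
      using V P unfolding Suc by simp
  qed
  finally show ?thesis by simp
qed

section \<open>Specialization to the indeterminates\<close>

lemma indet_nonzero: "(indet i :: 'a::idom rat_funs) \<noteq> 0"
proof -
  have "Poly_Mapping.single (Poly_Mapping.single i (1::nat)) (1::'a) \<noteq> 0"
    by (metis lookup_single_eq lookup_zero one_neq_zero)
  then show ?thesis
    by (simp add: indet_def eq_fract Zero_fract_def)
qed

theorem theorem5p5:
  fixes k n r s :: nat
  assumes "k \<ge> 1" and "n \<ge> 1" and "r \<le> 3 * k - 1" and "s \<le> 3 * k - 1"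
  shows "motzkin_mu_int b_seq lam_seq (3 * k - 1) (- int n) r s =
    (-1) ^ (r div 3 + s div 3) *
    ((\<Prod>i\<le>s. indet i) / (\<Prod>i<r. indet i)) *
    (\<Sum>as\<in>PV3 (3 * k - 1) (n - 1) r s. seq_weight (indet :: nat \<Rightarrow> 'a::idom rat_funs) as)"
proof -
  let ?K = "3 * k - 1" and ?V = "indet :: nat \<Rightarrow> 'a rat_funs"
  have K: "Suc ?K = 3 * k" using assms(1) by simp
  have b: "b_seq = (\<lambda>i. - inverse (?V i))"
    and lam: "lam_seq = (\<lambda>i. inverse (?V i) * inverse (?V (i - 1)))"
    by (auto simp: b_seq_def lam_seq_def)
  define g where "g = two_sided_power ?V b_seq lam_seq ?K s"
  have "recurrence_extends (\<lambda>N. g (int N) r) (\<lambda>N. g N r)"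
  proof (rule recurrence_extends_orth_poly)
    show "g (N + 1) x = g N (Suc x) + b_seq x * g N x +
        (if x = 0 then 0 else lam_seq x * g N (x - 1))" if "x \<le> ?K" for N x
      unfolding g_def b lam
      by (rule two_sided_power_rec[OF indet_nonzero that assms(4) K])
    show "g N (Suc ?K) = 0" for N
      unfolding g_def by (rule two_sided_power_top[OF assms(4) K])
    show "coeff (orth_poly b_seq lam_seq (Suc ?K)) 0 \<noteq> (0 :: 'a rat_funs)"
      unfolding K b lam by (rule coeff_0_orth_poly) (rule indet_nonzero)
  qed (fact assms)
  moreover have "(\<lambda>N. g (int N) r) = (\<lambda>N. motzkin_mu b_seq lam_seq ?K N r s)"
    by (simp add: g_def)
  ultimately have "motzkin_mu_int b_seq lam_seq ?K (- int n) r s = g (- int n) r"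
    unfolding motzkin_mu_int_def by (simp only: negative_extension_eq)
  also have "nat (int n - 1) = n - 1" using assms(2) by simp
  then have "g (- int n) r = (-1) ^ (r div 3 + s div 3) *
    ((\<Prod>i\<le>s. indet i) / (\<Prod>i<r. indet i)) * pv_sum ?V ?K (n - 1) r s"
    using assms(2) by (simp add: g_def two_sided_power_def)
  finally show ?thesis
    by (simp add: pv_sum_def)
qed

end
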